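(* Let $\kappa\in\{\operatorname{cf}(\mathfrak d),\mathfrak d\}$, and let $X\subseteq[\mathbb N]^{\infty}$ be a bi-$\kappa$-unbounded set. Then: (1) The real set $X\cup[\mathbb N]^{<\infty}$ is $\kappa$-concentrated. In particular, it is Menger. (2) There is a $\mathfrak d$-concentrated real set $Y$ such that the product space $(X\cup[\mathbb N]^{<\infty})\times Y$ is not Menger.
   Context: $\mathbb N=\{1,2,\dots\}$. The family $P(\mathbb N)$ of all subsets of $\mathbb N$ is identified with the Cantor space $\{0,1\}^{\mathbb N}$, with its topology; $[\mathbb N]^{\infty}$ and $[\mathbb N]^{<\infty}$ are the subspaces of infinite and of finite subsets of $\mathbb N$, respectively. Each $a\in[\mathbb N]^\infty$ is identified with its increasing enumeration: $a(n)$ is the $n$-th element of $a$. A real set is a set of real numbers with the subspace topology; subspaces of $P(\mathbb N)$ are regarded as real sets (via the homeomorphism of $P(\mathbb N)$ with Cantor's set). For $a,b\in[\mathbb N]^\infty$: $a\le b$ means $a(n)\le b(n)$ for all $n$; $a\le^* b$ means $a(n)\le b(n)$ for all but finitely many $n$. A set $A\subseteq[\mathbb N]^\infty$ is $\le$-bounded if there is $b\in[\mathbb N]^\infty$ with $a\le b$ for all $a\in A$. A set $D\subseteq[\mathbb N]^\infty$ is dominating if for each $a\in[\mathbb N]^\infty$ there is $d\in D$ with $a\le^* d$; $\mathfrak d$ is the minimal cardinality of a dominating set, and $\operatorname{cf}(\mathfrak d)$ is its cofinality. For an infinite cardinal $\kappa$, a set $A\subseteq[\mathbb N]^\infty$ with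 $|A|\ge\kappa$ is $\kappa$-unbounded if every $\le$-bounded subset of $A$ has cardinality smaller than $\kappa$. For $a\in P(\mathbb N)$ let $a^{c}=\mathbb N\setminus a$, and let $[\mathbb N]^{\infty,\infty}$ be the family of infinite sets $a\subseteq\mathbb N$ with $a^c$ infinite. A set $X\subseteq[\mathbb N]^{\infty,\infty}$ is bi-$\kappa$-unbounded if the sets $X$ and $\{x^c: x\in X\}$ are both $\kappa$-unbounded. A topological space $X$ with $|X|\ge\kappa$ is $\kappa$-concentrated if there is a countable set $D\subseteq X$ such that $|X\setminus U|<\kappa$ for all open sets $U\supseteq D$. A topological space $X$ is Menger if for each sequence $\mathcal U_1,\mathcal U_2,\dots$ of open covers of $X$ there are finite sets $\mathcal F_1\subseteq\mathcal U_1,\mathcal F_2\subseteq\mathcal U_2,\dots$ whose union covers $X$. *)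

theory Defs
  imports "HOL-Analysis.Analysis"
begin

unbundle cardinal_syntax

abbreviation Npos :: "nat set"
  where "Npos \<equiv> {1..}"

definition cantor :: "nat set topology"
  where "cantor =
    pullback_topology (Pow Npos) (\<lambda>a. \<lambda>n\<in>Npos. n \<in> a)
      (product_topology (\<lambda>_. discrete_topology (UNIV :: bool set)) Npos)"

definition inf_subsets :: "nat set set"
  where "inf_subsets = {a. a \<subseteq> Npos \<and> infinite a}"

definition fin_subsets :: "nat set set"
  where "fin_subsets = {a. a \<subseteq> Npos \<and> finite a}"

definition inf_coinf_subsets :: "nat set set"
  where "inf_coinf_subsets = {a. a \<subseteq> Npos \<and> infinite a \<and> infinite (Npos - a)}"

text \<open>The \<open>n\<close>-th element of \<open>a\<close> is \<open>enumerate a (n - 1)\<close>, as \<^const>\<open>enumerate\<close>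
  counts from \<open>0\<close>.\<close>

definition le_enum :: "nat set \<Rightarrow> nat set \<Rightarrow> bool"
  where "le_enum a b \<longleftrightarrow> (\<forall>n. enumerate a n \<le> enumerate b n)"

definition le_star :: "nat set \<Rightarrow> nat set \<Rightarrow> bool"
  where "le_star a b \<longleftrightarrow> (\<forall>\<^sub>\<infinity>n. enumerate a n \<le> enumerate b n)"

definition le_bounded :: "nat set set \<Rightarrow> bool"
  where "le_bounded A \<longleftrightarrow> (\<exists>b\<in>inf_subsets. \<forall>a\<in>A. le_enum a b)"

definition dominating :: "nat set set \<Rightarrow> bool"
  where "dominating D \<longleftrightarrow>
    D \<subseteq> inf_subsets \<and> (\<forall>a\<in>inf_subsets. \<exists>d\<in>D. le_star a d)"

text \<open>Cardinals are represented by cardinal orders, up to \<open>=o\<close>. The lemmas below show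
  that the choices are well defined.\<close>

definition dfrak :: "nat set rel"
  where "dfrak = |SOME D. dominating D \<and> (\<forall>D'. dominating D' \<longrightarrow> |D| \<le>o |D'| )|"

text \<open>The library's \<^const>\<open>cofinal\<close> asks for strict upper bounds; the usual notion, which
  makes sense for every order, does not.\<close>

definition cofinal_subset :: "'a set \<Rightarrow> 'a rel \<Rightarrow> bool"
  where "cofinal_subset K r \<longleftrightarrow> K \<subseteq> Field r \<and> (\<forall>a\<in>Field r. \<exists>b\<in>K. (a, b) \<in> r)"

definition cof :: "'a rel \<Rightarrow> 'a rel"
  where "cof r = |SOME K. cofinal_subset K r \<and> (\<forall>K'. cofinal_subset K' r \<longrightarrow> |K| \<le>o |K'| )|"

lemma exists_min_card:
  assumes "P (A :: 'a set)"
  shows "\<exists>B. P B \<and> (\<forall>B'. P B' \<longrightarrow> |B| \<le>o |B'| )"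
  using exists_minim_Card_order[of "card_of ` Collect P"] assms card_of_Card_order by blast

lemma dfrak_minimal:
  "\<exists>D. dominating D \<and> dfrak = |D| \<and> (\<forall>D'. dominating D' \<longrightarrow> |D| \<le>o |D'| )"
proof -
  have "dominating inf_subsets"
    unfolding dominating_def le_star_def by (metis MOST_I order_refl subset_refl)
  from someI_ex[OF exists_min_card[of dominating, OF this]]
  show ?thesis unfolding dfrak_def by blast
qed

lemma cof_minimal:
  assumes "Well_order r"
  shows "\<exists>K. cofinal_subset K r \<and> cof r = |K| \<and> (\<forall>K'. cofinal_subset K' r \<longrightarrow> |K| \<le>o |K'| )"
proof -
  have "cofinal_subset (Field r) r"
    using assms unfolding cofinal_subset_def order_on_defs refl_on_def by blast
  from someI_ex[OF exists_min_card[of "\<lambda>K. cofinal_subset K r", OF this]]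
  show ?thesis unfolding cof_def by blast
qed

definition k_unbounded :: "'k rel \<Rightarrow> nat set set \<Rightarrow> bool"
  where "k_unbounded \<kappa> A \<longleftrightarrow>
    A \<subseteq> inf_subsets \<and> \<kappa> \<le>o |A| \<and> (\<forall>B\<subseteq>A. le_bounded B \<longrightarrow> |B| <o \<kappa>)"

definition bi_k_unbounded :: "'k rel \<Rightarrow> nat set set \<Rightarrow> bool"
  where "bi_k_unbounded \<kappa> X \<longleftrightarrow>
    X \<subseteq> inf_coinf_subsets \<and> k_unbounded \<kappa> X \<and> k_unbounded \<kappa> ((\<lambda>x. Npos - x) ` X)"

definition k_concentrated :: "'k rel \<Rightarrow> 'a topology \<Rightarrow> bool"
  where "k_concentrated \<kappa> T \<longleftrightarrow>
    \<kappa> \<le>o |topspace T| \<and>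
    (\<exists>D. countable D \<and> D \<subseteq> topspace T \<and>
      (\<forall>U. openin T U \<and> D \<subseteq> U \<longrightarrow> |topspace T - U| <o \<kappa>))"

definition open_cover_of :: "'a topology \<Rightarrow> 'a set set \<Rightarrow> bool"
  where "open_cover_of T \<U> \<longleftrightarrow> (\<forall>U\<in>\<U>. openin T U) \<and> topspace T \<subseteq> \<Union>\<U>"

definition Menger_space :: "'a topology \<Rightarrow> bool"
  where "Menger_space T \<longleftrightarrow>
    (\<forall>\<U> :: nat \<Rightarrow> 'a set set. (\<forall>n. open_cover_of T (\<U> n)) \<longrightarrow>
      (\<exists>\<F>. (\<forall>n. finite (\<F> n) \<and> \<F> n \<subseteq> \<U> n) \<and> topspace T \<subseteq> (\<Union>n. \<Union>(\<F> n))))"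

end

theory Submission
  imports Defs
begin

text \<open>A set that is open around all finite sets misses only a \<open>\<le>\<close>-bounded family, so
  \<open>X \<union> Fin\<close> is concentrated on the countable set of finite sets; since \<open>\<kappa> \<le> \<dd>\<close>, what remains
  after covering the finite sets is too small to dominate, which gives Menger's property.

  For the second part, spread a dominating family \<open>D\<close> of size \<open>\<dd>\<close> over \<open>X\<close> by a map \<open>h\<close> such that
  fewer than \<open>\<kappa>\<close> points of \<open>X\<close> absorb fewer than \<open>\<dd>\<close> elements of \<open>D\<close>. For \<open>d \<in> D\<close> choose an
  infinite \<open>v \<subseteq> h(d)\<^sup>c\<close> with \<open>d \<le> v\<close>, and let \<open>Y\<close> consist of these pairs \<open>(h(d)\<^sup>c, v)\<close> together with
  all pairs of finite sets \<open>v \<subseteq> u\<close>. As \<open>v \<subseteq> u\<close> throughout, unboundedness of the complements makes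
  \<open>Y\<close> concentrated on the finite pairs. On the closed set of all \<open>(x, (u, v))\<close> with \<open>u = x\<^sup>c\<close>
  no finite pair survives, since every \<open>x\<close> is coinfinite, and \<open>v\<close> ranges over a dominating family,
  which is impossible for a Menger space.\<close>

section \<open>Infinite sets and their enumerations\<close>

lemma enumerate_range_strict_mono:
  fixes s :: "nat \<Rightarrow> nat"
  assumes "strict_mono s"
  shows "enumerate (range s) n = s n"
proof (induction n)
  case 0
  show ?case unfolding enumerate_0
    by (rule Least_equality) (use assms in \<open>auto simp: strict_mono_less_eq\<close>)
next
  case (Suc n)
  have "infinite (range s)"
    using assms strict_mono_imp_inj_on finite_imageD by blast
  then show ?case unfolding enumerate_Suc''[OF \<open>infinite (range s)\<close>] Suc.IH
    by (intro Least_equality) (use assms in \<open>auto simp: strict_mono_less strict_mono_less_eq\<close>)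
qed

text \<open>The \<open>k\<close>-th element of an infinite set of naturals is at least
  \<open>k\<close>, so it suffices to keep elements of \<open>u\<close> whose indices grow fast
  enough.\<close>

lemma exists_sparse_subset:
  fixes f :: "nat \<Rightarrow> nat"
  assumes "infinite u"
  obtains v where "v \<subseteq> u" "infinite v" "\<And>n. f n \<le> enumerate v n"
proof -
  \<comment> \<open>The partial sum pushes the index above \<open>f n\<close> and never decreases;
    the summand \<open>n\<close> makes the increase strict even where \<open>f\<close>
    vanishes.\<close>
  define s where "s n = enumerate u ((\<Sum>i\<le>n. f i) + n)" for n
  have "strict_mono s"
    unfolding strict_mono_Suc_iff s_def by (auto intro!: enumerate_mono assms)
  moreover have "f n \<le> s n" for n
  proof -
    have "f n \<le> (\<Sum>i\<le>n. f i) + n" by (simp add: member_le_sum trans_le_add1)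
    also have "\<dots> \<le> s n" unfolding s_def by (rule le_enumerate[OF assms])
    finally show ?thesis .
  qed
  moreover have "infinite (range s)"
    using \<open>strict_mono s\<close> strict_mono_imp_inj_on finite_imageD by blast
  moreover have "range s \<subseteq> u"
    unfolding s_def using enumerate_in_set[OF assms] by auto
  ultimately show ?thesis
    using that[of "range s"] by (simp add: enumerate_range_strict_mono)
qed

text \<open>Every window from \<open>n\<close> (excluded) to \<open>g n\<close> meets
  \<open>u\<close>, so each further application of \<open>g\<close>, starting at 0, passes at least
  one more element of \<open>u\<close>.\<close>

lemma enumerate_le_of_gaps:
  fixes g :: "nat \<Rightarrow> nat"
  assumes gap: "\<And>n. \<exists>i\<in>u. n < i \<and> i \<le> g n"
  shows "enumerate u k \<le> (g ^^ Suc k) 0"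
proof -
  have inf: "infinite u"
    using gap unfolding infinite_nat_iff_unbounded by blast
  show ?thesis
  proof (induction k)
    case 0
    obtain i where "i \<in> u" "i \<le> g 0" using gap by blast
    then show ?case unfolding enumerate_0 by (auto intro: Least_le order_trans)
  next
    case (Suc k)
    obtain i where i: "i \<in> u" "(g ^^ Suc k) 0 < i" "i \<le> g ((g ^^ Suc k) 0)"
      using gap by blast
    then have "enumerate u (Suc k) \<le> i"
      unfolding enumerate_Suc''[OF inf] using Suc.IH by (auto intro!: Least_le)
    with i show ?case by simp
  qed
qed

text \<open>Turns a bound on the enumeration into a condition on \<open>v \<inter> {..m}\<close>
  alone. Such conditions are open, which the covers of the non-Menger product rely on.\<close>

lemma less_card_Int_atMost_iff:
  fixes v :: "nat set"
  assumes "infinite v"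
  shows "n < card (v \<inter> {..m}) \<longleftrightarrow> enumerate v n \<le> m"
proof
  assume "n < card (v \<inter> {..m})"
  show "enumerate v n \<le> m"
  proof (rule ccontr)
    assume *: "\<not> enumerate v n \<le> m"
    have "v \<inter> {..m} \<subseteq> enumerate v ` {..<n}"
    proof
      fix i assume "i \<in> v \<inter> {..m}"
      then obtain k where "i = enumerate v k"
        using enumerate_Ex by (metis IntD1 assms)
      moreover have "k < n"
        using * \<open>i \<in> v \<inter> {..m}\<close> calculation enumerate_mono_iff[OF assms, of k n] by (simp add: not_le)
      ultimately show "i \<in> enumerate v ` {..<n}" by blast
    qed
    from card_mono[OF _ this] card_image_le[of "{..<n}" "enumerate v"]
    show False using \<open>n < card (v \<inter> {..m})\<close> by auto
  qed
next
  assume "enumerate v n \<le> m"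
  moreover have "enumerate v k \<le> enumerate v n" if "k \<le> n" for k
    using that by (simp add: enumerate_mono_le_iff[OF assms])
  ultimately have "enumerate v ` {..n} \<subseteq> v \<inter> {..m}"
    using enumerate_in_set[OF assms] by (meson IntI atMost_iff image_subsetI order_trans)
  from card_mono[OF _ this] show "n < card (v \<inter> {..m})"
    by (simp add: card_image inj_on_subset[OF inj_enumerate[OF assms]])
qed

text \<open>For a single open set around the finite sets, take a \<open>P\<close> that ignores \<open>v\<close>.\<close>

lemma bounded_off_finite_pairs:
  fixes P :: "nat set \<Rightarrow> nat set \<Rightarrow> bool"
  assumes nbhd: "\<And>F G. F \<in> fin_subsets \<Longrightarrow> G \<subseteq> F \<Longrightarrow> \<exists>m. \<forall>u v. u \<subseteq> Npos \<longrightarrow> v \<subseteq> u \<longrightarrow>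
      u \<inter> {..m} = F \<inter> {..m} \<longrightarrow> v \<inter> {..m} = G \<inter> {..m} \<longrightarrow> P u v"
  shows "le_bounded {u. u \<subseteq> Npos \<and> (\<exists>v\<subseteq>u. \<not> P u v)}"
proof -
  obtain M where M: "P u v"
    if "F \<in> fin_subsets" "G \<subseteq> F" "u \<subseteq> Npos" "v \<subseteq> u"
      "u \<inter> {..M F G} = F \<inter> {..M F G}" "v \<inter> {..M F G} = G \<inter> {..M F G}" for F G u v
    using nbhd by metis
  \<comment> \<open>The sum exceeds the radius of every pair inside \<open>{..n}\<close>; arbitrary
    values of \<open>M\<close> at other pairs only enlarge it. \<open>Suc n\<close> makes the
    iterates of \<open>g\<close> strictly increasing.\<close>
  define g where "g n = Suc n + (\<Sum>F\<in>Pow {..n}. \<Sum>G\<in>Pow {..n}. M F G)" for n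
  have M_le: "M F G \<le> g n" if "F \<subseteq> {..n}" "G \<subseteq> {..n}" for F G n
  proof -
    have "M F G \<le> (\<Sum>G\<in>Pow {..n}. M F G)"
      using that by (intro member_le_sum) auto
    also have "\<dots> \<le> (\<Sum>F\<in>Pow {..n}. \<Sum>G\<in>Pow {..n}. M F G)"
      using that by (intro member_le_sum[of F _ "\<lambda>F. \<Sum>G\<in>Pow {..n}. M F G"]) auto
    finally show ?thesis unfolding g_def by simp
  qed
  \<comment> \<open>One initial application of \<open>g\<close> keeps the values positive, hence in
    \<open>Npos\<close>, and matches the bound in \<open>enumerate_le_of_gaps\<close>.\<close>
  define b where "b k = (g ^^ Suc k) 0" for k
  have "strict_mono b"
    unfolding strict_mono_Suc_iff b_def by (simp add: g_def)
  have "range b \<in> inf_subsets"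
  proof -
    have "infinite (range b)"
      using \<open>strict_mono b\<close> strict_mono_imp_inj_on finite_imageD by blast
    moreover have "b k \<ge> 1" for k unfolding b_def by (simp add: g_def)
    ultimately show ?thesis unfolding inf_subsets_def by auto
  qed
  moreover have "le_enum u (range b)" if u: "u \<subseteq> Npos" "v \<subseteq> u" "\<not> P u v" for u v
  proof -
    have "\<exists>i\<in>u. n < i \<and> i \<le> g n" for n
    proof (rule ccontr)
      assume no: "\<not> ?thesis"
      \<comment> \<open>If \<open>u\<close> misses the window after \<open>n\<close>, then
        \<open>u\<close> and its subset \<open>v\<close> agree with these truncations up to
        \<open>M ?F ?G\<close>, so they lie in a neighbourhood where \<open>P\<close> holds.\<close>
      let ?F = "u \<inter> {..n}" and ?G = "v \<inter> {..n}"
      have "M ?F ?G \<le> g n" by (rule M_le) auto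
      then have "\<not> (\<exists>i\<in>u. n < i \<and> i \<le> M ?F ?G)" using no by (meson order_trans)
      then have "u \<inter> {..M ?F ?G} = ?F \<inter> {..M ?F ?G}" "v \<inter> {..M ?F ?G} = ?G \<inter> {..M ?F ?G}"
        using u(2) by (auto simp: not_less)
      moreover have "?F \<in> fin_subsets" using u unfolding fin_subsets_def by auto
      ultimately have "P u v" using M[of ?F ?G u v] u by blast
      with u show False by blast
    qed
    from enumerate_le_of_gaps[OF this] show ?thesis
      unfolding le_enum_def enumerate_range_strict_mono[OF \<open>strict_mono b\<close>] b_def by blast
  qed
  ultimately show ?thesis unfolding le_bounded_def by blast
qed

section \<open>Cardinals\<close>

lemma Card_order_dfrak: "Card_order dfrak"
  using dfrak_minimal card_of_Card_order by metis

lemma not_dominating_if_small: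
  assumes "|A| <o dfrak"
  shows "\<not> dominating A"
  using assms dfrak_minimal not_ordLess_ordLeq by metis

text \<open>Functions are replaced by infinite sets \<open>V z\<close> whose enumerations lie above
  them; a set \<open>a\<close> that no \<open>V z\<close> dominates supplies
  \<open>g\<close>.\<close>

lemma not_dominated_if_small:
  fixes f :: "'a \<Rightarrow> nat \<Rightarrow> nat"
  assumes "|Z| <o dfrak"
  obtains g where "\<And>z. z \<in> Z \<Longrightarrow> \<exists>\<^sub>\<infinity>n. f z n \<le> g n"
proof -
  have "\<exists>v. v \<subseteq> Npos \<and> infinite v \<and> (\<forall>n. f z n \<le> enumerate v n)" for z
    using exists_sparse_subset[of Npos "f z"] infinite_Ici by metis
  then obtain V where V: "V z \<subseteq> Npos" "infinite (V z)" "f z n \<le> enumerate (V z) n" for z n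
    by metis
  have "|V ` Z| <o dfrak"
    using card_of_image assms by (rule ordLeq_ordLess_trans)
  then have "\<not> dominating (V ` Z)" by (rule not_dominating_if_small)
  moreover have "V ` Z \<subseteq> inf_subsets" using V unfolding inf_subsets_def by auto
  ultimately obtain a where a: "\<And>z. z \<in> Z \<Longrightarrow> \<not> le_star a (V z)"
    unfolding dominating_def by blast
  have "\<exists>\<^sub>\<infinity>n. f z n \<le> enumerate a n" if "z \<in> Z" for z
  proof -
    have "\<exists>\<^sub>\<infinity>n. \<not> enumerate a n \<le> enumerate (V z) n"
      using a[OF that] unfolding le_star_def by (simp add: not_MOST)
    then show ?thesis
      by (rule INFM_mono) (meson V(3) linear order_trans)
  qed
  with that show ?thesis by blast
qed

lemma cof_ordLeq:
  assumes "Card_order r"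
  shows "cof r \<le>o r"
proof -
  have W: "Well_order r" using assms card_order_on_well_order_on by blast
  then have "cofinal_subset (Field r) r"
    unfolding cofinal_subset_def order_on_defs refl_on_def by blast
  with cof_minimal[OF W] have "cof r \<le>o |Field r|" by metis
  then show ?thesis using card_of_Field_ordIso[OF assms] ordLeq_ordIso_trans by blast
qed

text \<open>For \<open>\<kappa> = r\<close> any injection works. For
  \<open>\<kappa> = cof r\<close>, send \<open>d\<close> to a point above it in a minimal cofinal
  set \<open>K\<close> and inject \<open>K\<close> into \<open>X\<close>: fewer than
  \<open>\<kappa>\<close> points of \<open>K\<close> are not cofinal, so their preimage lies in a
  proper initial segment.\<close>

lemma small_fibres_map:
  fixes r :: "'a rel" and X :: "'b set"
  assumes r: "Card_order r" and \<kappa>: "\<kappa> = cof r \<or> \<kappa> = r" and le: "\<kappa> \<le>o |X|"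
  obtains h where "h ` Field r \<subseteq> X"
    "\<And>Z. |Z| <o \<kappa> \<Longrightarrow> |{d \<in> Field r. h d \<in> Z}| <o r"
  using \<kappa>
proof
  assume "\<kappa> = r"
  then have "|Field r| \<le>o |X|"
    using card_of_Field_ordIso[OF r] le ordIso_ordLeq_trans by blast
  then obtain g where g: "inj_on g (Field r)" "g ` Field r \<subseteq> X"
    using card_of_ordLeq[of "Field r" X] by blast
  have "|{d \<in> Field r. g d \<in> Z}| <o r" if "|Z| <o \<kappa>" for Z
  proof -
    have "|{d \<in> Field r. g d \<in> Z}| \<le>o |Z|"
      using g by (intro card_of_ordLeqI[of g]) (auto simp: inj_on_def)
    then show ?thesis using that \<open>\<kappa> = r\<close> ordLeq_ordLess_trans by blast
  qed
  with g that show ?thesis by blast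
next
  assume "\<kappa> = cof r"
  have W: "Well_order r" using r card_order_on_well_order_on by blast
  obtain K where K: "cofinal_subset K r" "cof r = |K|"
    "\<And>K'. cofinal_subset K' r \<Longrightarrow> |K| \<le>o |K'|"
    using cof_minimal[OF W] by blast
  have "|K| \<le>o |X|" using le K(2) \<open>\<kappa> = cof r\<close> by simp
  then obtain g where g: "inj_on g K" "g ` K \<subseteq> X"
    using card_of_ordLeq[of K X] by blast
  obtain k where k: "k d \<in> K" "(d, k d) \<in> r" if "d \<in> Field r" for d
    using K(1) unfolding cofinal_subset_def by metis
  have "|{d \<in> Field r. g (k d) \<in> Z}| <o r" if "|Z| <o \<kappa>" for Z
  proof -
    define K' where "K' = {b \<in> K. g b \<in> Z}"
    have "|K'| \<le>o |Z|"
      using g by (intro card_of_ordLeqI[of g]) (auto simp: inj_on_def K'_def)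
    then have "|K'| <o |K|"
      using that K(2) \<open>\<kappa> = cof r\<close> ordLeq_ordLess_trans by auto
    then have "\<not> cofinal_subset K' r" using K(3) not_ordLess_ordLeq by blast
    moreover have "K' \<subseteq> Field r" using K(1) unfolding K'_def cofinal_subset_def by blast
    ultimately obtain a where a: "a \<in> Field r" "\<And>b. b \<in> K' \<Longrightarrow> (a, b) \<notin> r"
      unfolding cofinal_subset_def by blast
    \<comment> \<open>Here \<open>d\<close> is at most \<open>k d\<close>, which is strictly below
      \<open>a\<close>; proper initial segments of a cardinal order are smaller than it.\<close>
    have "{d \<in> Field r. g (k d) \<in> Z} \<subseteq> underS r a"
    proof
      fix d assume d: "d \<in> {d \<in> Field r. g (k d) \<in> Z}"
      then have "(a, k d) \<notin> r" using a k unfolding K'_def by blast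
      moreover have "k d \<in> Field r" using d k by (auto intro: FieldI2)
      ultimately have "(k d, a) \<in> r"
        using W a(1) unfolding order_on_defs refl_on_def total_on_def by metis
      then have "(d, a) \<in> r"
        using W k d unfolding order_on_defs trans_def by blast
      moreover have "d \<noteq> a" using \<open>(a, k d) \<notin> r\<close> k d by blast
      ultimately show "d \<in> underS r a" unfolding underS_def by blast
    qed
    then show ?thesis
      using card_of_underS[OF r a(1)] card_of_mono1 ordLeq_ordLess_trans by blast
  qed
  moreover have "(\<lambda>d. g (k d)) ` Field r \<subseteq> X" using g k by blast
  ultimately show ?thesis using that by blast
qed

section \<open>The Cantor space\<close>

lemma topspace_cantor: "topspace cantor = Pow Npos"
  unfolding cantor_def topspace_pullback_topology by auto

lemma openin_cantor_cylinder:
  assumes "a \<subseteq> Npos"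
  shows "openin cantor {b. b \<subseteq> Npos \<and> b \<inter> {..m} = a \<inter> {..m}}"
proof -
  let ?B = "\<lambda>i. if 1 \<le> i \<and> i \<le> m then {i \<in> a} else (UNIV :: bool set)"
  have "finite {i. ?B i \<noteq> UNIV}"
    by (rule finite_subset[of _ "{..m}"]) auto
  then have "openin (product_topology (\<lambda>_. discrete_topology (UNIV :: bool set)) Npos) (Pi\<^sub>E Npos ?B)"
    by (intro product_topology_basis) auto
  moreover have "{b. b \<subseteq> Npos \<and> b \<inter> {..m} = a \<inter> {..m}} =
    (\<lambda>a. \<lambda>n\<in>Npos. n \<in> a) -` Pi\<^sub>E Npos ?B \<inter> Pow Npos" (is "?L = ?R")
  proof (intro set_eqI)
    fix b
    have "b \<in> ?R \<longleftrightarrow> b \<subseteq> Npos \<and> (\<forall>i\<in>Npos. i \<le> m \<longrightarrow> (i \<in> b \<longleftrightarrow> i \<in> a))"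
      by (auto simp: PiE_iff split: if_splits)
    also have "\<dots> \<longleftrightarrow> b \<in> ?L"
      using assms by (auto simp: set_eq_iff)
    finally show "b \<in> ?L \<longleftrightarrow> b \<in> ?R" by simp
  qed
  ultimately show ?thesis
    unfolding cantor_def openin_pullback_topology by blast
qed

text \<open>A basic open set of the product restricts finitely many coordinates, and
  \<open>m\<close> bounds them all.\<close>

lemma openin_cantor_nbhd:
  assumes "openin cantor U" "a \<in> U"
  obtains m where "\<And>b. b \<subseteq> Npos \<Longrightarrow> b \<inter> {..m} = a \<inter> {..m} \<Longrightarrow> b \<in> U"
proof -
  let ?f = "\<lambda>a. \<lambda>n\<in>Npos. n \<in> a"
  obtain W where W: "openin (product_topology (\<lambda>_. discrete_topology (UNIV :: bool set)) Npos) W"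
    "U = ?f -` W \<inter> Pow Npos"
    using assms(1) unfolding cantor_def openin_pullback_topology by blast
  have "?f a \<in> W" using W assms(2) by blast
  then obtain V where V: "finite {i \<in> Npos. V i \<noteq> UNIV}" "?f a \<in> Pi\<^sub>E Npos V" "Pi\<^sub>E Npos V \<subseteq> W"
    using W(1) unfolding openin_product_topology_alt topspace_discrete_topology by meson
  obtain m where m: "\<And>i. i \<in> Npos \<Longrightarrow> V i \<noteq> UNIV \<Longrightarrow> i \<le> m"
    using V(1) unfolding finite_nat_set_iff_bounded_le by blast
  have "b \<in> U" if b: "b \<subseteq> Npos" "b \<inter> {..m} = a \<inter> {..m}" for b
  proof -
    have "(i \<in> b) \<in> V i" if i: "i \<in> Npos" for i
    proof (cases "V i = UNIV")
      case False
      then have "i \<le> m" using m i by blast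
      then have "i \<in> b \<longleftrightarrow> i \<in> a" using b(2) by (auto simp: set_eq_iff)
      moreover have "(i \<in> a) \<in> V i" using V(2) i by (auto simp: PiE_iff)
      ultimately show ?thesis by simp
    qed simp
    then have "?f b \<in> Pi\<^sub>E Npos V" by (simp add: PiE_iff)
    then show ?thesis using V(3) W(2) b by blast
  qed
  then show ?thesis by (rule that)
qed

lemma openin_subtopology_cantor_nbhd:
  assumes "openin (subtopology cantor A) U" "A \<subseteq> Pow Npos" "a \<in> U"
  obtains m where "\<And>b. b \<in> A \<Longrightarrow> b \<inter> {..m} = a \<inter> {..m} \<Longrightarrow> b \<in> U"
proof -
  obtain W where W: "openin cantor W" "U = W \<inter> A"
    using assms(1) unfolding openin_subtopology by blast
  have "a \<in> W" using W(2) assms(3) by blast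
  then obtain m where m: "\<And>b. b \<subseteq> Npos \<Longrightarrow> b \<inter> {..m} = a \<inter> {..m} \<Longrightarrow> b \<in> W"
    using openin_cantor_nbhd[OF W(1)] by metis
  show ?thesis
  proof (rule that)
    fix b assume b: "b \<in> A" "b \<inter> {..m} = a \<inter> {..m}"
    then have "b \<subseteq> Npos" using assms(2) by blast
    from m[OF this b(2)] b(1) show "b \<in> U" unfolding W(2) by simp
  qed
qed

lemma openin_subtopology_cantor_cylinder:
  assumes "A \<subseteq> Pow Npos" "a \<in> A"
  shows "openin (subtopology cantor A) {b \<in> A. b \<inter> {..m} = a \<inter> {..m}}"
proof -
  have *: "{b \<in> A. b \<inter> {..m} = a \<inter> {..m}} = {b. b \<subseteq> Npos \<and> b \<inter> {..m} = a \<inter> {..m}} \<inter> A"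
    using assms(1) by auto
  show ?thesis
    unfolding * by (intro openin_subtopology_Int openin_cantor_cylinder) (use assms in blast)
qed

lemma le_bounded_subset: "le_bounded B \<Longrightarrow> A \<subseteq> B \<Longrightarrow> le_bounded A"
  unfolding le_bounded_def by blast

lemma countable_fin_subsets: "countable fin_subsets"
  unfolding fin_subsets_def
  by (rule countable_subset[OF _ countable_Collect_finite]) auto

section \<open>Concentration and Menger's property\<close>

text \<open>What \<open>U\<close> leaves out is \<open>\<le>\<close>-bounded, and it lies in
  \<open>X\<close> because the finite sets are covered.\<close>

lemma k_unbounded_small_complement:
  assumes X: "k_unbounded \<kappa> X" and U: "openin (subtopology cantor (X \<union> fin_subsets)) U"
    and fin: "fin_subsets \<subseteq> U"
  shows "|(X \<union> fin_subsets) - U| <o \<kappa>"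
proof -
  have sub: "X \<union> fin_subsets \<subseteq> Pow Npos"
    using X unfolding k_unbounded_def inf_subsets_def fin_subsets_def by blast
  \<comment> \<open>Vacuous outside the subspace, so that the bounding lemma, which ranges over all
    \<open>u \<subseteq> Npos\<close>, applies.\<close>
  let ?P = "\<lambda>u v :: nat set. u \<in> X \<union> fin_subsets \<longrightarrow> u \<in> U"
  have "le_bounded {u. u \<subseteq> Npos \<and> (\<exists>v\<subseteq>u. \<not> ?P u v)}"
  proof (rule bounded_off_finite_pairs)
    fix F G :: "nat set" assume "F \<in> fin_subsets"
    then obtain m where "\<And>b. b \<in> X \<union> fin_subsets \<Longrightarrow> b \<inter> {..m} = F \<inter> {..m} \<Longrightarrow> b \<in> U"
      using openin_subtopology_cantor_nbhd[OF U sub] fin by blast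
    then show "\<exists>m. \<forall>u v. u \<subseteq> Npos \<longrightarrow> v \<subseteq> u \<longrightarrow>
      u \<inter> {..m} = F \<inter> {..m} \<longrightarrow> v \<inter> {..m} = G \<inter> {..m} \<longrightarrow> ?P u v" by blast
  qed
  then have "le_bounded ((X \<union> fin_subsets) - U)"
    by (rule le_bounded_subset) (use sub in auto)
  moreover have "(X \<union> fin_subsets) - U \<subseteq> X" using fin by blast
  ultimately show ?thesis using X unfolding k_unbounded_def by simp
qed

lemma k_unbounded_imp_k_concentrated:
  assumes "k_unbounded \<kappa> X"
  shows "k_concentrated \<kappa> (subtopology cantor (X \<union> fin_subsets))"
proof -
  have top: "topspace (subtopology cantor (X \<union> fin_subsets)) = X \<union> fin_subsets"
    using assms unfolding k_unbounded_def inf_subsets_def fin_subsets_def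
    by (auto simp: topspace_cantor)
  have "\<kappa> \<le>o |X|" using assms unfolding k_unbounded_def by blast
  then have "\<kappa> \<le>o |X \<union> fin_subsets|"
    by (rule ordLeq_transitive) (rule card_of_mono1, rule Un_upper1)
  moreover have "\<forall>U. openin (subtopology cantor (X \<union> fin_subsets)) U \<and> fin_subsets \<subseteq> U \<longrightarrow>
      |(X \<union> fin_subsets) - U| <o \<kappa>"
    using k_unbounded_small_complement[OF assms] by blast
  ultimately show ?thesis
    unfolding k_concentrated_def top using countable_fin_subsets by blast
qed

text \<open>One set per cover catches the finite sets and leaves fewer than \<open>dfrak\<close>
  points. Their radius functions do not dominate, so one \<open>g\<close> meets each of them
  infinitely often, and only finitely many traces on \<open>{..g n}\<close> must be served at stage
  \<open>n\<close>.\<close>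

lemma k_unbounded_imp_Menger_space:
  assumes X: "k_unbounded \<kappa> X" and \<kappa>: "\<kappa> \<le>o dfrak"
  shows "Menger_space (subtopology cantor (X \<union> fin_subsets))"
  unfolding Menger_space_def
proof (intro allI impI)
  let ?A = "X \<union> fin_subsets"
  let ?T = "subtopology cantor ?A"
  fix \<U> :: "nat \<Rightarrow> nat set set set"
  assume cover: "\<forall>n. open_cover_of ?T (\<U> n)"
  have sub: "?A \<subseteq> Pow Npos"
    using X unfolding k_unbounded_def inf_subsets_def fin_subsets_def by blast
  then have top: "topspace ?T = ?A" by (auto simp: topspace_cantor)
  have ex: "\<exists>C\<in>\<U> n. a \<in> C" if "a \<in> ?A" for a n
    using cover that top unfolding open_cover_of_def by blast
  have fin_ne: "fin_subsets \<noteq> {}" unfolding fin_subsets_def by blast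
  define q where "q = from_nat_into fin_subsets"
  have q: "range q = fin_subsets"
    unfolding q_def by (rule range_from_nat_into[OF fin_ne countable_fin_subsets])
  then have "\<forall>n. \<exists>C\<in>\<U> n. q n \<in> C" using ex by blast
  then obtain C where C: "C n \<in> \<U> n" "q n \<in> C n" for n by metis
  have "openin ?T (\<Union>n. C n)"
    using C(1) cover unfolding open_cover_of_def by blast
  moreover have "fin_subsets \<subseteq> (\<Union>n. C n)"
    unfolding q[symmetric] using C(2) by auto
  ultimately have "|?A - (\<Union>n. C n)| <o dfrak"
    by (intro ordLess_ordLeq_trans[OF k_unbounded_small_complement[OF X] \<kappa>])
  define good where
    "good n m a E \<longleftrightarrow> E \<in> \<U> n \<and> (\<forall>b\<in>?A. b \<inter> {..m} = a \<inter> {..m} \<longrightarrow> b \<in> E)" for n m a E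
  have "\<exists>m E. good n m a E" if a: "a \<in> ?A" for a n
  proof -
    obtain E where E: "E \<in> \<U> n" "a \<in> E" using ex a by blast
    then have "openin ?T E" using cover unfolding open_cover_of_def by blast
    from openin_subtopology_cantor_nbhd[OF this sub E(2)] E(1) show ?thesis
      unfolding good_def by metis
  qed
  then obtain f where f: "\<exists>E. good n (f a n) a E" if "a \<in> ?A" for a n by metis
  obtain g where g: "\<exists>\<^sub>\<infinity>n. f a n \<le> g n" if "a \<in> ?A - (\<Union>n. C n)" for a
    using not_dominated_if_small[OF \<open>|?A - (\<Union>n. C n)| <o dfrak\<close>, of f] by blast
  \<comment> \<open>One member per trace: being good at radius \<open>g n\<close> depends only on
    the trace of the point on \<open>{..g n}\<close>.\<close>
  define e where "e n a = (SOME E. good n (g n) a E)" for n a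
  \<comment> \<open>Intersecting with \<open>\<U> n\<close> discards the arbitrary choices at traces
    that have no good member.\<close>
  define \<F> where "\<F> n = insert (C n) (e n ` Pow {..g n} \<inter> \<U> n)" for n
  have "a \<in> (\<Union>n. \<Union>(\<F> n))" if a: "a \<in> ?A" for a
  proof (cases "a \<in> (\<Union>n. C n)")
    case True
    then show ?thesis unfolding \<F>_def by blast
  next
    case False
    then obtain n where n: "f a n \<le> g n" using g a by (metis DiffI INFM_E)
    obtain E where "good n (f a n) a E" using f a by blast
    then have "good n (g n) (a \<inter> {..g n}) E"
    proof -
      have "b \<inter> {..f a n} = a \<inter> {..f a n}" if "b \<inter> {..g n} = (a \<inter> {..g n}) \<inter> {..g n}" for b
        using that n unfolding set_eq_iff by (metis Int_iff atMost_iff order_trans)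
      with \<open>good n (f a n) a E\<close> show ?thesis unfolding good_def by metis
    qed
    then have good: "good n (g n) (a \<inter> {..g n}) (e n (a \<inter> {..g n}))"
      unfolding e_def by (rule someI)
    then have "a \<in> e n (a \<inter> {..g n})" "e n (a \<inter> {..g n}) \<in> \<F> n"
      using a unfolding good_def \<F>_def by auto
    then show ?thesis by blast
  qed
  then have "topspace ?T \<subseteq> (\<Union>n. \<Union>(\<F> n))" using top by blast
  moreover have "finite (\<F> n) \<and> \<F> n \<subseteq> \<U> n" for n
    unfolding \<F>_def using C(1) by auto
  ultimately show "\<exists>\<F>. (\<forall>n. finite (\<F> n) \<and> \<F> n \<subseteq> \<U> n) \<and> topspace ?T \<subseteq> (\<Union>n. \<Union>(\<F> n))"
    by blast
qed

text \<open>Applying Menger's property to every tail of the sequence of covers makes the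
  selection catch each point infinitely often, not just once.\<close>

lemma Menger_space_increasing_covers:
  fixes U :: "nat \<Rightarrow> nat \<Rightarrow> 'a set"
  assumes T: "Menger_space T" and op: "\<And>n m. openin T (U n m)"
    and mono: "\<And>n. mono (U n)" and cover: "\<And>n. topspace T \<subseteq> (\<Union>m. U n m)"
  obtains g where "\<And>x. x \<in> topspace T \<Longrightarrow> \<exists>\<^sub>\<infinity>n. x \<in> U n (g n)"
proof -
  have "\<exists>G. topspace T \<subseteq> (\<Union>n. U (n + k) (G n))" for k
  proof -
    have "open_cover_of T (range (U (n + k)))" for n
      using op cover unfolding open_cover_of_def by auto
    then obtain \<F> where \<F>: "\<And>n. finite (\<F> n) \<and> \<F> n \<subseteq> range (U (n + k))"
      "topspace T \<subseteq> (\<Union>n. \<Union>(\<F> n))"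
      using T[unfolded Menger_space_def, rule_format, of "\<lambda>n. range (U (n + k))"] by auto
    have "\<exists>j. \<Union>(\<F> n) \<subseteq> U (n + k) j" for n
    proof -
      obtain M where M: "finite M" "\<F> n = U (n + k) ` M"
        using \<F>(1) finite_subset_image by metis
      \<comment> \<open>The covers are increasing, so a finite selection can be replaced by a single
        index.\<close>
      obtain j where "\<forall>i\<in>M. i \<le> j" using M(1) finite_nat_set_iff_bounded_le by blast
      then have "\<Union>(\<F> n) \<subseteq> U (n + k) j"
        unfolding M(2) using mono by (auto dest: monoD)
      then show ?thesis ..
    qed
    then obtain G where "\<And>n. \<Union>(\<F> n) \<subseteq> U (n + k) (G n)" by metis
    then have "(\<Union>n. \<Union>(\<F> n)) \<subseteq> (\<Union>n. U (n + k) (G n))" by (intro UN_mono) auto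
    with \<F>(2) have "topspace T \<subseteq> (\<Union>n. U (n + k) (G n))" by (rule order_trans)
    then show ?thesis by (intro exI[of _ G])
  qed
  then obtain G where G: "topspace T \<subseteq> (\<Union>n. U (n + k) (G k n))" for k by metis
  \<comment> \<open>Stage \<open>n\<close> is stage \<open>n - k\<close> of the tail starting at
    \<open>k\<close>; the sum bounds the selections of all tails begun by then.\<close>
  define g where "g n = (\<Sum>k\<le>n. G k (n - k))" for n
  have "\<exists>\<^sub>\<infinity>n. x \<in> U n (g n)" if x: "x \<in> topspace T" for x
    unfolding INFM_nat_le
  proof
    fix k
    obtain n where n: "x \<in> U (n + k) (G k n)" using G x by blast
    have "G k (n + k - k) \<le> g (n + k)"
      unfolding g_def by (rule member_le_sum[of k _ "\<lambda>j. G j (n + k - j)"]) auto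
    then have "x \<in> U (n + k) (g (n + k))"
      using n mono by (auto dest: monoD)
    then show "\<exists>n\<ge>k. x \<in> U n (g n)" by (meson le_add2)
  qed
  with that show ?thesis by blast
qed

section \<open>Coding pairs of sets by reals\<close>

text \<open>The terms after index \<open>n\<close> contribute at most the geometric tail of
  \<open>3 / 7 ^ k\<close>, which is half of \<open>1 / 7 ^ n\<close>.\<close>

lemma base7_leading_digit:
  fixes c :: "nat \<Rightarrow> real"
  assumes bound: "\<And>k. \<bar>c k\<bar> \<le> 3" and zero: "\<And>k. k < n \<Longrightarrow> c k = 0"
  shows "summable (\<lambda>k. c k / 7 ^ k)"
    and "\<bar>(\<Sum>k. c k / 7 ^ k) - c n / 7 ^ n\<bar> \<le> 1 / (2 * 7 ^ n)"
proof -
  have geo: "(\<lambda>k. 3 * (1 / 7) ^ k) sums (7 / 2 :: real)"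
    using sums_mult[OF geometric_sums[of "1 / 7 :: real"], of 3] by simp
  have bd: "\<bar>c k / 7 ^ k\<bar> \<le> 3 * (1 / 7) ^ k" for k
    using bound[of k] by (simp add: abs_divide power_divide divide_right_mono)
  show summ: "summable (\<lambda>k. c k / 7 ^ k)"
    using bd by (intro summable_comparison_test'[OF sums_summable[OF geo]]) auto
  have "(\<Sum>k. c k / 7 ^ k) - c n / 7 ^ n = (\<Sum>k. c (k + Suc n) / 7 ^ (k + Suc n))"
    using zero by (subst suminf_split_initial_segment[OF summ, of "Suc n"]) simp
  moreover have "\<bar>\<Sum>k. c (k + Suc n) / 7 ^ (k + Suc n)\<bar> \<le> 1 / (2 * 7 ^ n)"
  proof -
    have tail: "(\<lambda>k. 3 * (1 / 7) ^ (k + Suc n)) sums (1 / (2 * 7 ^ n) :: real)"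
      using sums_mult2[OF geo, of "(1 / 7) ^ Suc n"] by (simp add: power_add power_divide field_simps)
    have "norm (\<Sum>k. c (k + Suc n) / 7 ^ (k + Suc n)) \<le> (\<Sum>k. 3 * (1 / 7) ^ (k + Suc n))"
      using bd by (intro norm_suminf_le sums_summable[OF tail]) (simp only: real_norm_def)
    then show ?thesis using sums_unique[OF tail] by simp
  qed
  ultimately show "\<bar>(\<Sum>k. c k / 7 ^ k) - c n / 7 ^ n\<bar> \<le> 1 / (2 * 7 ^ n)" by simp
qed

text \<open>Embeds pairs of sets in the real line, as the second factor must be a set of reals. The
  digit, from 0 to 3, records membership of \<open>n\<close> in both sets; digit differences are at
  most 3, so in base 7 the first nonzero one outweighs all later ones.\<close>

definition pair_code :: "nat set \<Rightarrow> nat set \<Rightarrow> real"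
  where "pair_code u v = (\<Sum>n. (of_bool (n \<in> u) + 2 * of_bool (n \<in> v)) / 7 ^ n)"

lemma pair_code_diff:
  defines "c u v u' v' k \<equiv>
    of_bool (k \<in> u) + 2 * of_bool (k \<in> v) - (of_bool (k \<in> u') + 2 * of_bool (k \<in> v') :: real)"
  assumes "\<And>k. k < n \<Longrightarrow> c u v u' v' k = 0"
  shows "\<bar>pair_code u v - pair_code u' v' - c u v u' v' n / 7 ^ n\<bar> \<le> 1 / (2 * 7 ^ n)"
proof -
  have summ: "summable (\<lambda>k. (of_bool (k \<in> u) + 2 * of_bool (k \<in> v) :: real) / 7 ^ k)" for u v
    \<comment> \<open>With \<open>n = 0\<close> the premise on vanishing digits is vacuous.\<close>
    by (rule base7_leading_digit(1)[of _ 0]) auto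
  have "pair_code u v - pair_code u' v' = (\<Sum>k. c u v u' v' k / 7 ^ k)"
    unfolding pair_code_def c_def suminf_diff[OF summ summ] diff_divide_distrib ..
  moreover have "\<bar>c u v u' v' k\<bar> \<le> 3" for k unfolding c_def by auto
  ultimately show ?thesis
    using base7_leading_digit(2)[of "c u v u' v'" n] assms(2) by simp
qed

text \<open>Continuity of the coding: the digit difference at index \<open>m\<close> itself is also
  0, so only the tail remains.\<close>

lemma pair_code_close:
  assumes "u \<inter> {..m} = u' \<inter> {..m}" "v \<inter> {..m} = v' \<inter> {..m}"
  shows "\<bar>pair_code u v - pair_code u' v'\<bar> \<le> 1 / (2 * 7 ^ m)"
proof -
  have *: "(k \<in> u \<longleftrightarrow> k \<in> u') \<and> (k \<in> v \<longleftrightarrow> k \<in> v')" if "k \<le> m" for k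
    using assms that unfolding set_eq_iff by auto
  show ?thesis
    using pair_code_diff[of m u v u' v'] *[OF order_refl] *[OF less_imp_le] by simp
qed

text \<open>Continuity of the inverse: at the first disagreement \<open>n\<close> the integer digits
  differ by at least 1, and the tail cancels at most half of \<open>1 / 7 ^ n\<close>.\<close>

lemma pair_code_separates:
  assumes "\<bar>pair_code u v - pair_code u' v'\<bar> < 1 / (2 * 7 ^ m)"
  shows "u \<inter> {..m} = u' \<inter> {..m}" "v \<inter> {..m} = v' \<inter> {..m}"
proof -
  let ?agree = "\<lambda>k. (k \<in> u \<longleftrightarrow> k \<in> u') \<and> (k \<in> v \<longleftrightarrow> k \<in> v')"
  have "?agree k" if "k \<le> m" for k
  proof (rule ccontr)
    assume "\<not> ?agree k"
    define n where "n = (LEAST k. \<not> ?agree k)"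
    have n: "\<not> ?agree n" unfolding n_def by (rule LeastI) fact
    have "n \<le> k" unfolding n_def by (rule Least_le) fact
    have less: "?agree j" if "j < n" for j
      using that not_less_Least unfolding n_def by blast
    define c :: real where
      "c = of_bool (n \<in> u) + 2 * of_bool (n \<in> v) - (of_bool (n \<in> u') + 2 * of_bool (n \<in> v'))"
    have "1 \<le> \<bar>c\<bar>" using n unfolding c_def by (auto split: if_splits)
    then have "1 / 7 ^ n \<le> \<bar>c / 7 ^ n\<bar>" by (simp add: abs_divide divide_right_mono)
    moreover have "\<bar>pair_code u v - pair_code u' v' - c / 7 ^ n\<bar> \<le> 1 / (2 * 7 ^ n)"
      unfolding c_def using less by (intro pair_code_diff) simp
    moreover have "(1 :: real) / (2 * 7 ^ m) \<le> 1 / (2 * 7 ^ n)"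
      using \<open>n \<le> k\<close> that by (intro divide_left_mono) (auto intro: power_increasing)
    moreover have "(1 :: real) / 7 ^ n = 1 / (2 * 7 ^ n) + 1 / (2 * 7 ^ n)" by simp
    ultimately show False using assms by linarith
  qed
  then show "u \<inter> {..m} = u' \<inter> {..m}" "v \<inter> {..m} = v' \<inter> {..m}" by auto
qed

lemma pair_code_inject: "pair_code u v = pair_code u' v' \<longleftrightarrow> u = u' \<and> v = v'"
proof
  assume "pair_code u v = pair_code u' v'"
  then have "u \<inter> {..m} = u' \<inter> {..m} \<and> v \<inter> {..m} = v' \<inter> {..m}" for m
    using pair_code_separates[of u v u' v' m] by simp
  then show "u = u' \<and> v = v'" unfolding set_eq_iff by (metis IntD1 IntI atMost_iff order_refl)
qed simp

lemma pair_code_nbhd: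
  assumes "open W" "pair_code u v \<in> W"
  obtains m where "\<And>u' v'. u' \<inter> {..m} = u \<inter> {..m} \<Longrightarrow> v' \<inter> {..m} = v \<inter> {..m} \<Longrightarrow> pair_code u' v' \<in> W"
proof -
  obtain \<epsilon> where \<epsilon>: "\<epsilon> > 0" "\<And>y. \<bar>y - pair_code u v\<bar> < \<epsilon> \<Longrightarrow> y \<in> W"
    using assms unfolding open_dist dist_real_def by blast
  obtain m where "(1 / 7) ^ m < \<epsilon>" using real_arch_pow_inv[OF \<epsilon>(1), of "1 / 7"] by auto
  then have "1 / (2 * 7 ^ m) < \<epsilon>" by (simp add: power_divide field_simps)
  then show ?thesis using that[of m] \<epsilon>(2) pair_code_close by (meson le_less_trans)
qed

section \<open>The second factor\<close>

lemma exists_concentrated_factor_not_Menger: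
  fixes \<kappa> :: "nat set rel"
  assumes \<kappa>: "\<kappa> = cof dfrak \<or> \<kappa> = dfrak" and X: "bi_k_unbounded \<kappa> X"
  shows "\<exists>Y :: real set. k_concentrated dfrak (top_of_set Y) \<and>
    \<not> Menger_space (prod_topology (subtopology cantor (X \<union> fin_subsets)) (top_of_set Y))"
proof -
  let ?A = "X \<union> fin_subsets"
  have unb: "k_unbounded \<kappa> X" "k_unbounded \<kappa> ((\<lambda>x. Npos - x) ` X)"
    and X_sub: "X \<subseteq> inf_coinf_subsets"
    using X unfolding bi_k_unbounded_def by auto
  have A_sub: "?A \<subseteq> Pow Npos"
    using X_sub unfolding inf_coinf_subsets_def fin_subsets_def by blast
  \<comment> \<open>Finite \<open>x\<close> are included, since the covers below must deal with
    every point of the first factor.\<close>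
  have coinf: "infinite (Npos - x)" if "x \<in> ?A" for x
    using that X_sub infinite_Ici[of "1 :: nat"] Diff_infinite_finite[of x Npos]
    unfolding inf_coinf_subsets_def fin_subsets_def by auto
  obtain D where D: "dominating D" "dfrak = |D|" using dfrak_minimal by blast
  \<comment> \<open>The order \<open>dfrak\<close> lives on \<open>D\<close>, so
    \<open>small_fibres_map\<close> applies to the dominating family itself.\<close>
  then have Field: "Field dfrak = D" using Field_card_of by metis
  have "\<kappa> \<le>o |X|" using unb unfolding k_unbounded_def by blast
  then obtain h where h: "h ` D \<subseteq> X"
    "\<And>Z. |Z| <o \<kappa> \<Longrightarrow> |{d \<in> D. h d \<in> Z}| <o dfrak"
    using small_fibres_map[OF Card_order_dfrak \<kappa>, of X] unfolding Field by blast
  have "\<exists>v\<subseteq>Npos - h d. infinite v \<and> (\<forall>n. enumerate d n \<le> enumerate v n)" if "d \<in> D" for d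
    using exists_sparse_subset[of "Npos - h d" "enumerate d"] coinf h(1) that
    by (metis Un_iff image_subset_iff)
  then obtain V where V: "V d \<subseteq> Npos - h d" "infinite (V d)"
    "enumerate d n \<le> enumerate (V d) n" if "d \<in> D" for d n
    by metis
  define S\<^sub>0 where "S\<^sub>0 = {(u, v). u \<in> fin_subsets \<and> v \<subseteq> u}"
  define S where "S = (\<lambda>d. (Npos - h d, V d)) ` D \<union> S\<^sub>0"
  define Y where "Y = case_prod pair_code ` S"
  have "k_concentrated dfrak (top_of_set Y)"
    unfolding k_concentrated_def topspace_euclidean_subtopology
  proof (intro conjI exI allI impI)
    \<comment> \<open>Enlarging every \<open>d\<close> keeps the family dominating; this yields the
      lower bound \<open>dfrak\<close> on the size of \<open>Y\<close>.\<close>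
    have "dominating (V ` D)"
      unfolding dominating_def
    proof (intro conjI ballI)
      show "V ` D \<subseteq> inf_subsets" using V unfolding inf_subsets_def by blast
      fix a assume "a \<in> inf_subsets"
      then obtain d where d: "d \<in> D" "le_star a d" using D(1) unfolding dominating_def by blast
      then have "le_star a (V d)"
        unfolding le_star_def using V(3)[OF d(1)] by (auto elim!: MOST_mono intro: order_trans)
      with d show "\<exists>v\<in>V ` D. le_star a v" by blast
    qed
    then have "dfrak \<le>o |V ` D|" using dfrak_minimal by metis
    also have "|V ` D| \<le>o |S|"
    proof (rule ordLeq_transitive[OF card_of_mono1 card_of_image])
      show "V ` D \<subseteq> snd ` S" unfolding S_def by force
    qed
    also have "|S| \<le>o |Y|"
      unfolding Y_def
      by (rule card_of_ordLeqI[of "case_prod pair_code"]) (auto simp: inj_on_def pair_code_inject)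
    finally show "dfrak \<le>o |Y|" .
    have "S\<^sub>0 \<subseteq> fin_subsets \<times> fin_subsets"
      unfolding S\<^sub>0_def fin_subsets_def by (auto intro: finite_subset)
    then have "countable S\<^sub>0"
      by (rule countable_subset) (intro countable_SIGMA countable_fin_subsets)
    then show "countable (case_prod pair_code ` S\<^sub>0)" by (rule countable_image)
    show "case_prod pair_code ` S\<^sub>0 \<subseteq> Y" unfolding Y_def S_def by blast
    fix U assume "openin (top_of_set Y) U \<and> case_prod pair_code ` S\<^sub>0 \<subseteq> U"
    then obtain W where W: "open W" "U = Y \<inter> W" "case_prod pair_code ` S\<^sub>0 \<subseteq> W"
      unfolding openin_open by blast
    \<comment> \<open>Quantifying over all \<open>v \<subseteq> u\<close> gives a condition on
      \<open>u\<close> alone, to which unboundedness of the complements applies.\<close>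
    define B where "B = {u. u \<subseteq> Npos \<and> (\<exists>v\<subseteq>u. pair_code u v \<notin> W)}"
    have "le_bounded B"
      unfolding B_def
    proof (rule bounded_off_finite_pairs)
      fix F G :: "nat set" assume "F \<in> fin_subsets" "G \<subseteq> F"
      then have "pair_code F G \<in> W" using W(3) unfolding S\<^sub>0_def by blast
      from pair_code_nbhd[OF W(1) this]
      show "\<exists>m. \<forall>u v. u \<subseteq> Npos \<longrightarrow> v \<subseteq> u \<longrightarrow> u \<inter> {..m} = F \<inter> {..m} \<longrightarrow>
        v \<inter> {..m} = G \<inter> {..m} \<longrightarrow> pair_code u v \<in> W" by metis
    qed
    then have "le_bounded ((\<lambda>x. Npos - x) ` X \<inter> B)"
      by (rule le_bounded_subset) (rule Int_lower2)
    then have "|(\<lambda>x. Npos - x) ` X \<inter> B| <o \<kappa>"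
      using unb(2) unfolding k_unbounded_def by (meson Int_lower1)
    \<comment> \<open>Complementation is injective on \<open>X\<close>, so the bound passes from
      complements back to points of \<open>X\<close>, where \<open>h\<close> takes its
      values.\<close>
    moreover have "|{x \<in> X. Npos - x \<in> B}| \<le>o |(\<lambda>x. Npos - x) ` X \<inter> B|"
      using A_sub by (intro card_of_ordLeqI[of "\<lambda>x. Npos - x"]) (auto intro!: inj_onI)
    ultimately have "|{d \<in> D. h d \<in> {x \<in> X. Npos - x \<in> B}}| <o dfrak"
      by (intro h(2)) (rule ordLeq_ordLess_trans)
    moreover have "Y - U \<subseteq> (\<lambda>d. pair_code (Npos - h d) (V d)) ` {d \<in> D. h d \<in> {x \<in> X. Npos - x \<in> B}}"
    proof
      fix y assume y: "y \<in> Y - U"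
      then obtain d where d: "d \<in> D" "y = pair_code (Npos - h d) (V d)"
        using W unfolding Y_def S_def by auto
      then have "Npos - h d \<in> B" using y V(1) W(2) unfolding B_def by blast
      with d h(1) show "y \<in> (\<lambda>d. pair_code (Npos - h d) (V d)) ` {d \<in> D. h d \<in> {x \<in> X. Npos - x \<in> B}}"
        by blast
    qed
    ultimately show "|Y - U| <o dfrak"
      using ordLeq_ordLess_trans[OF ordLeq_transitive[OF card_of_mono1 card_of_image]] by blast
  qed
  moreover have "\<not> Menger_space (prod_topology (subtopology cantor ?A) (top_of_set Y))"
  proof
    let ?T = "prod_topology (subtopology cantor ?A) (top_of_set Y)"
    assume Menger: "Menger_space ?T"
    have top: "topspace ?T = ?A \<times> Y" using A_sub by (auto simp: topspace_cantor)
    \<comment> \<open>The first disjunct covers everything off the closed set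
      \<open>u = Npos - x\<close>, so no closed subspace is needed. On that set, for infinite
      \<open>v\<close>, \<open>Q\<close> says \<open>enumerate v n \<le> m\<close>.\<close>
    define Q where "Q n m x u v \<longleftrightarrow>
      u \<inter> {..m} \<noteq> (Npos - x) \<inter> {..m} \<or> n < card (v \<inter> {..m})" for n m and x u v :: "nat set"
    define U where "U n m = {(x, pair_code u v) | x u v. x \<in> ?A \<and> (u, v) \<in> S \<and> Q n m x u v}" for n m
    have U_iff: "(x, pair_code u v) \<in> U n m \<longleftrightarrow> x \<in> ?A \<and> (u, v) \<in> S \<and> Q n m x u v" for x u v n m
      unfolding U_def by (auto simp: pair_code_inject)
    have "openin ?T (U n m)" for n m
      unfolding openin_prod_topology_alt
    proof (intro allI impI)
      fix x y assume xy: "(x, y) \<in> U n m"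
      then obtain u v where uv: "y = pair_code u v" "x \<in> ?A" "(u, v) \<in> S" "Q n m x u v"
        unfolding U_def by blast
      \<comment> \<open>The ball has the radius of \<open>pair_code_separates\<close>, so codes in
        it share their traces on \<open>{..m}\<close>, on which \<open>Q\<close> depends.\<close>
      let ?N = "{b \<in> ?A. b \<inter> {..m} = x \<inter> {..m}}" and ?M = "Y \<inter> ball y (1 / (2 * 7 ^ m))"
      have "(x', y') \<in> U n m" if x': "x' \<in> ?N" and y': "y' \<in> ?M" for x' y'
      proof -
        obtain u' v' where uv': "y' = pair_code u' v'" "(u', v') \<in> S"
          using y' unfolding Y_def by auto
        have "\<bar>pair_code u v - pair_code u' v'\<bar> < 1 / (2 * 7 ^ m)"
          using y' uv uv' by (simp add: dist_real_def)
        note eq = pair_code_separates[OF this]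
        have "(Npos - x) \<inter> {..m} = (Npos - x') \<inter> {..m}"
          using x' by (simp add: Diff_Int_distrib2)
        then have "Q n m x' u' v'" using uv(4) unfolding Q_def eq by simp
        with x' uv' show ?thesis by (simp add: U_iff)
      qed
      moreover have "x \<in> ?N" "y \<in> ?M" using uv unfolding Y_def by auto
      moreover have "openin (top_of_set Y) ?M" by (simp add: openin_open_Int)
      moreover have "openin (subtopology cantor ?A) ?N"
        using openin_subtopology_cantor_cylinder[OF A_sub uv(2)] .
      ultimately show "\<exists>N M. openin (subtopology cantor ?A) N \<and> openin (top_of_set Y) M \<and>
        x \<in> N \<and> y \<in> M \<and> N \<times> M \<subseteq> U n m" by blast
    qed
    moreover have "mono (U n)" for n
    proof
      fix m m' :: nat assume le: "m \<le> m'"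
      have "Q n m' x u v" if "Q n m x u v" for x u v
      proof -
        have "E \<inter> {..m} = (E \<inter> {..m'}) \<inter> {..m}" for E using le by auto
        moreover have "card (v \<inter> {..m}) \<le> card (v \<inter> {..m'})"
          using le by (intro card_mono) auto
        ultimately show ?thesis using that unfolding Q_def by (metis less_le_trans)
      qed
      then show "U n m \<subseteq> U n m'" unfolding U_def by blast
    qed
    moreover have "topspace ?T \<subseteq> (\<Union>m. U n m)" for n
    proof
      fix p assume "p \<in> topspace ?T"
      then obtain x u v where p: "p = (x, pair_code u v)" "x \<in> ?A" "(u, v) \<in> S"
        unfolding top Y_def by auto
      have "\<exists>m. Q n m x u v"
      proof (cases "u = Npos - x")
        case True
        then have "infinite u" using coinf p(2) by blast
        \<comment> \<open>An infinite \<open>u\<close> excludes the finite pairs, leaving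
          \<open>v = V d\<close> for some \<open>d\<close> in \<open>D\<close>.\<close>
        then have "infinite v"
          using p(3) V(2) unfolding S_def S\<^sub>0_def fin_subsets_def by auto
        then show ?thesis unfolding Q_def using less_card_Int_atMost_iff by blast
      next
        case False
        then obtain i where "i \<in> u \<longleftrightarrow> i \<notin> Npos - x" by blast
        then have "Q n i x u v" unfolding Q_def by (metis Int_iff atMost_iff order_refl)
        then show ?thesis ..
      qed
      with p show "p \<in> (\<Union>m. U n m)" by (simp add: U_iff)
    qed
    ultimately obtain g where g: "\<exists>\<^sub>\<infinity>n. p \<in> U n (g n)" if "p \<in> topspace ?T" for p
      using Menger_space_increasing_covers[OF Menger] by blast
    \<comment> \<open>\<open>Suc\<close> makes the comparison strict: \<open>g n\<close> is below
      \<open>enumerate a n\<close>, hence eventually below \<open>enumerate (V d) n\<close>.\<close>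
    obtain a where a: "a \<subseteq> Npos" "infinite a" "\<And>n. Suc (g n) \<le> enumerate a n"
      using exists_sparse_subset[of Npos "\<lambda>n. Suc (g n)"] infinite_Ici by metis
    then obtain d where d: "d \<in> D" "le_star a d"
      using D(1) unfolding dominating_def inf_subsets_def by blast
    \<comment> \<open>At this point the first disjunct of \<open>Q\<close> fails for every radius,
      so each capture by the selection forces \<open>enumerate (V d) n \<le> g n\<close>.\<close>
    have "(h d, pair_code (Npos - h d) (V d)) \<in> topspace ?T"
      unfolding top using d(1) h(1) by (auto simp: Y_def S_def)
    from g[OF this] have "\<exists>\<^sub>\<infinity>n. enumerate (V d) n \<le> g n"
      unfolding U_iff Q_def less_card_Int_atMost_iff[OF V(2)[OF d(1)]]
      by (auto elim: INFM_mono)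
    moreover have "\<forall>\<^sub>\<infinity>n. \<not> enumerate (V d) n \<le> g n"
      using d(2) unfolding le_star_def
    proof (rule MOST_mono)
      fix n assume "enumerate a n \<le> enumerate d n"
      with a(3)[of n] V(3)[OF d(1), of n] show "\<not> enumerate (V d) n \<le> g n" by linarith
    qed
    ultimately show False by (simp add: not_MOST[symmetric] frequently_def)
  qed
  ultimately show ?thesis by blast
qed

theorem theorem3p2:
  fixes \<kappa> :: "nat set rel" and X :: "nat set set"
  assumes "\<kappa> \<in> {cof dfrak, dfrak}"
    and "X \<subseteq> inf_subsets"
    and "bi_k_unbounded \<kappa> X"
  shows "(k_concentrated \<kappa> (subtopology cantor (X \<union> fin_subsets)) \<and>
          Menger_space (subtopology cantor (X \<union> fin_subsets))) \<and>
         (\<exists>Y :: real set. k_concentrated dfrak (top_of_set Y) \<and>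
            \<not> Menger_space (prod_topology (subtopology cantor (X \<union> fin_subsets)) (top_of_set Y)))"
proof -
  have "\<kappa> \<le>o dfrak"
    using assms(1) cof_ordLeq[OF Card_order_dfrak] ordLeq_refl[OF Card_order_dfrak] by blast
  moreover have "k_unbounded \<kappa> X" using assms(3) unfolding bi_k_unbounded_def by blast
  ultimately show ?thesis
    using k_unbounded_imp_k_concentrated k_unbounded_imp_Menger_space
      exists_concentrated_factor_not_Menger assms(1,3) by blast
qed

end
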